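(* Let $k\ge 2$ and $q>1$ be fixed integers and let $t=q(k-1)+1$. Suppose that $m=m(n)\gg n^{k-\frac1q}$. Then $$\mathrm{satex}(n,\,P_k:\,m,\,P_t)=\left(\frac12+o(1)\right)\frac{(2m)^q}{n^{q-1}}.$$
   Context: All graphs are finite and simple. $P_k$ denotes the path on $k$ vertices (so of length $k-1$). A copy of a graph is a (not necessarily induced) subgraph isomorphic to it. $\mathrm{satex}(n,F:m,G)$ denotes the minimum number of copies of $G$ in an $n$-vertex graph having at least $m$ copies of $F$ (considered when such a graph exists). $f(n)\gg g(n)$ means $f(n)/g(n)\to\infty$ as $n\to\infty$; $o(1)$ is for $n\to\infty$ with $k,q$ fixed. *)

theory Defs
  imports Complex_Main
begin

type_synonym 'a graph = "'a set \<times> 'a set set"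

abbreviation verts :: "'a graph \<Rightarrow> 'a set" where "verts \<equiv> fst"

abbreviation edges :: "'a graph \<Rightarrow> 'a set set" where "edges \<equiv> snd"

definition simple_graph :: "'a graph \<Rightarrow> bool" where
  "simple_graph G \<longleftrightarrow> finite (verts G) \<and> (\<forall>e \<in> edges G. e \<subseteq> verts G \<and> card e = 2)"

definition subgraph :: "'a graph \<Rightarrow> 'a graph \<Rightarrow> bool" where
  "subgraph H G \<longleftrightarrow> simple_graph H \<and> verts H \<subseteq> verts G \<and> edges H \<subseteq> edges G"

definition isomorphic :: "'a graph \<Rightarrow> 'b graph \<Rightarrow> bool" where
  "isomorphic G H \<longleftrightarrow>
     (\<exists>f. bij_betw f (verts G) (verts H) \<and> edges H = (\<lambda>e. f ` e) ` edges G)"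

definition num_copies :: "'a graph \<Rightarrow> 'b graph \<Rightarrow> nat" where
  "num_copies F G = card {H. subgraph H G \<and> isomorphic F H}"

text \<open>The index counts vertices, so \<open>path_graph k\<close> has length \<open>k - 1\<close>.\<close>

definition path_graph :: "nat \<Rightarrow> nat graph" where
  "path_graph k = ({..<k}, {{i, Suc i} |i. Suc i < k})"

text \<open>Every finite graph has an isomorphic copy with vertices in \<^typ>\<open>nat\<close>, and
  \<^const>\<open>num_copies\<close> is invariant under isomorphism, so nothing is lost by taking all
  host graphs over \<^typ>\<open>nat\<close>.\<close>

definition satex_graphs :: "nat \<Rightarrow> 'a graph \<Rightarrow> nat \<Rightarrow> nat graph set" where
  "satex_graphs n F m = {H. simple_graph H \<and> card (verts H) = n \<and> m \<le> num_copies F H}"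

text \<open>On a nonempty set of naturals the infimum is attained, i.e. it is the minimum; if
  \<^const>\<open>satex_graphs\<close> is empty, the value below is meaningless.\<close>

definition satex :: "nat \<Rightarrow> 'a graph \<Rightarrow> nat \<Rightarrow> 'b graph \<Rightarrow> nat" where
  "satex n F m G = (INF H \<in> satex_graphs n F m. num_copies G H)"

end

theory Submission
  imports Defs
begin

text \<open>
  A copy of a path with at least two vertices has exactly two vertex sequences, one the reverse of
  the other, so copies are counted by duplicate-free walks (\<open>card_paths_eq_num_copies\<close>). Write
  \<open>X = (2 m)\<^sup>q / n\<^bsup>q-1\<^esup>\<close>.

  Lower bound. Let \<open>K u v\<close> be the number of \<open>k\<close>-vertex paths from \<open>u\<close> to \<open>v\<close>. This is a
  symmetric nonnegative kernel of total weight at least \<open>2 m\<close>, so the Blakley--Roy inequality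
  (\<open>blakley_roy\<close>) says that chains of \<open>q\<close> such paths, each starting where the previous one
  ends, number at least \<open>X\<close>. A chain is a walk with \<open>t\<close> vertices, because consecutive
  paths share one vertex. A walk that is not a path repeats a vertex, and there are at most
  \<open>t\<^sup>2 n\<^bsup>t-1\<^esup>\<close> sequences doing so. The growth condition on \<open>m\<close> is exactly what makes
  \<open>n\<^bsup>t-1\<^esup>\<close> negligible compared with \<open>X\<close>. Hence at least \<open>(1/2 - o(1)) X\<close> copies of the
  long path exist.

  Upper bound. In a graph with all degrees in \<open>{s - 1, s}\<close> both counts are known up to lower
  order terms: it has at least \<open>n (s-1)(s-2)\<dots>(s-k+1)\<close> vertex sequences of \<open>k\<close>-vertex paths and
  at most \<open>n s\<^bsup>t-1\<^esup>\<close> walks with \<open>t\<close> vertices. Such a graph exists for every \<open>s \<le> n\<close>, with the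
  complete graph at \<open>s = n\<close>, whose path count is the largest possible; so some \<open>s\<close> reaches
  \<open>2 m\<close> whenever any graph does. For the least such \<open>s\<close> the count at \<open>s - 1\<close> is
  below \<open>2 m\<close>, which gives \<open>s \<le> k + z\<close> with \<open>z\<^bsup>k-1\<^esup> = 2 m / n\<close>. Since
  \<open>n z\<^bsup>t-1\<^esup> = X\<close> and \<open>z\<close> tends to infinity, the number of walks is at most \<open>(1 + o(1)) X\<close>
  (\<open>exists_graph_few_paths\<close>).
\<close>

section \<open>The Blakley--Roy inequality\<close>

definition kernel_op :: "'a set \<Rightarrow> ('a \<Rightarrow> 'a \<Rightarrow> real) \<Rightarrow> ('a \<Rightarrow> real) \<Rightarrow> 'a \<Rightarrow> real" where
  "kernel_op V K f u = (\<Sum>v\<in>V. K u v * f v)"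

text \<open>
  The proof is the entropy argument in elementary form. Weight the vertices by their row sums
  \<open>d\<close>, with mean \<open>D\<close>; this weight is stationary for the random walk with transition
  probabilities \<open>K u v / d u\<close>. The total weight of chains with \<open>j + 1\<close> steps is the weighted
  sum of the expected product of \<open>d\<close> over the \<open>j\<close> inner vertices of a random chain. By
  convexity of \<open>exp\<close> that product is, on average, at least the exponential of the expected sum of
  \<open>ln d\<close>, and by stationarity each inner vertex contributes the same mean of \<open>ln d\<close>, which is at
  least \<open>ln D\<close>. No spectral theory enters, so odd and even exponents are treated alike.
\<close>

lemma blakley_roy:
  fixes K :: "'a \<Rightarrow> 'a \<Rightarrow> real"
  assumes fin: "finite V"
    and nonneg: "\<And>u v. 0 \<le> K u v"
    and sym: "\<And>u v. u \<in> V \<Longrightarrow> v \<in> V \<Longrightarrow> K u v = K v u"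
  shows "(\<Sum>u\<in>V. \<Sum>v\<in>V. K u v) ^ Suc j
    \<le> real (card V) ^ j * (\<Sum>u\<in>V. (kernel_op V K ^^ Suc j) (\<lambda>_. 1) u)"
proof -
  define d where "d u = (\<Sum>v\<in>V. K u v)" for u
  define s where "s = (\<Sum>u\<in>V. d u)"
  define h where "h i = (kernel_op V K ^^ i) (\<lambda>_. 1)" for i
  have h_Suc: "h (Suc i) u = (\<Sum>v\<in>V. K u v * h i v)" for i u
    by (simp add: h_def kernel_op_def)
  have h_nonneg: "0 \<le> h i u" for i u
    by (induction i arbitrary: u) (simp_all add: h_Suc sum_nonneg nonneg, simp add: h_def)
  have d_nonneg: "0 \<le> d u" for u
    by (simp add: d_def sum_nonneg nonneg)
  have K0: "K u v = 0" if "d u = 0" "v \<in> V" for u v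
    using that sum_nonneg_eq_0_iff[OF fin, of "K u"] nonneg by (simp add: d_def)
  have s_nonneg: "0 \<le> s"
    by (simp add: s_def sum_nonneg d_nonneg)
  have "s ^ Suc j \<le> real (card V) ^ j * (\<Sum>u\<in>V. h (Suc j) u)"
  proof (cases "s = 0")
    case True
    then show ?thesis by (simp add: sum_nonneg h_nonneg)
  next
    case False
    then have "V \<noteq> {}" by (auto simp: s_def)
    then have n_pos: "0 < real (card V)" using fin by (simp add: card_gt_0_iff)
    define D where "D = s / real (card V)"
    have D_pos: "0 < D" using False s_nonneg n_pos by (simp add: D_def)
    define L where "L u = ln (d u / D)" for u
    \<comment> \<open>\<open>Y i u\<close> is the expected sum of \<open>L\<close> along the \<open>i\<close> steps of the random walk that follow a start
      in \<open>u\<close>. Division by a zero row sum gives 0, which is harmless because the whole row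
      then vanishes.\<close>
    define Y where "Y = rec_nat (\<lambda>_. 0) (\<lambda>_ y u. (\<Sum>v\<in>V. K u v * (L v + y v)) / d u)"
    have Y_0: "Y 0 u = 0" for u by (simp add: Y_def)
    have "Y (Suc i) u = (\<Sum>v\<in>V. K u v * (L v + Y i v)) / d u" for i u
      by (simp add: Y_def)
    then have Y_Suc: "d u * Y (Suc i) u = (\<Sum>v\<in>V. K u v * (L v + Y i v))" for i u
      by (cases "d u = 0") (simp_all add: K0)
    have h_ge: "D ^ i * (d u * exp (Y i u)) \<le> h (Suc i) u" if "u \<in> V" for i u
      using that
    proof (induction i arbitrary: u)
      case 0
      show ?case by (simp add: h_Suc Y_0) (simp add: h_def d_def)
    next
      case (Suc i)
      let ?c = "Y (Suc i) u"
      have tilt: "D * (K u v * exp (L v + Y i v)) = K u v * (d v * exp (Y i v))"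
        if "v \<in> V" for v
      proof (cases "d v = 0")
        case True
        then have "K u v = 0" using K0[of v u] sym that Suc.prems by simp
        then show ?thesis by simp
      next
        case False
        then have "exp (L v) = d v / D"
          using d_nonneg[of v] D_pos by (simp add: L_def)
        then show ?thesis using D_pos by (simp add: exp_add)
      qed
      \<comment> \<open>Jensen's inequality for \<open>exp\<close>, in the form that the graph lies above its tangent at the
        mean \<open>?c\<close>.\<close>
      have tangent: "exp ?c * (K u v * (1 + (L v + Y i v) - ?c)) \<le> K u v * exp (L v + Y i v)" for v
      proof -
        have "exp ?c * (1 + ((L v + Y i v) - ?c)) \<le> exp ?c * exp ((L v + Y i v) - ?c)"
          by (intro mult_left_mono exp_ge_add_one_self) simp
        also have "\<dots> = exp (L v + Y i v)" by (simp flip: exp_add)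
        finally show ?thesis using mult_left_mono[OF _ nonneg[of u v]]
          by (fastforce simp: algebra_simps)
      qed
      have "K u v * (1 + (L v + Y i v) - ?c) = K u v + K u v * (L v + Y i v) - K u v * ?c" for v
        by (simp add: algebra_simps)
      then have "(\<Sum>v\<in>V. K u v * (1 + (L v + Y i v) - ?c))
          = d u + (\<Sum>v\<in>V. K u v * (L v + Y i v)) - d u * ?c"
        by (simp add: sum.distrib sum_subtractf d_def flip: sum_distrib_right)
      also have "\<dots> = d u" by (simp flip: Y_Suc)
      finally have "d u * exp ?c = exp ?c * (\<Sum>v\<in>V. K u v * (1 + (L v + Y i v) - ?c))" by simp
      also have "\<dots> \<le> (\<Sum>v\<in>V. K u v * exp (L v + Y i v))"
        unfolding sum_distrib_left by (intro sum_mono tangent)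
      finally have "D ^ Suc i * (d u * exp ?c)
          \<le> D ^ Suc i * (\<Sum>v\<in>V. K u v * exp (L v + Y i v))"
        using D_pos by simp
      also have "\<dots> = (\<Sum>v\<in>V. D ^ i * (D * (K u v * exp (L v + Y i v))))"
        by (simp add: sum_distrib_left mult_ac)
      also have "\<dots> = (\<Sum>v\<in>V. K u v * (D ^ i * (d v * exp (Y i v))))"
        by (intro sum.cong refl) (simp only: tilt mult_ac)
      also have "\<dots> \<le> (\<Sum>v\<in>V. K u v * h (Suc i) v)"
        by (intro sum_mono mult_left_mono Suc.IH nonneg)
      finally show ?case by (simp only: h_Suc[of "Suc i"])
    qed
    \<comment> \<open>From \<open>ln x \<le> x - 1\<close> at \<open>x = D / d u\<close>; the resulting bounds \<open>d u - D\<close> sum to zero.\<close>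
    have L_mean: "0 \<le> (\<Sum>u\<in>V. d u * L u)"
    proof -
      have "d u - D \<le> d u * L u" for u
      proof (cases "d u = 0")
        case True
        then show ?thesis using D_pos by simp
      next
        case False
        then have pos: "0 < d u" using d_nonneg[of u] by simp
        have "ln (D / d u) \<le> D / d u - 1"
          using pos D_pos by (intro ln_le_minus_one) simp
        then have "1 - D / d u \<le> L u"
          using pos D_pos by (simp add: L_def ln_div)
        then have "d u * (1 - D / d u) \<le> d u * L u"
          using pos by (intro mult_left_mono) auto
        then show ?thesis using pos by (simp add: algebra_simps)
      qed
      then have "(\<Sum>u\<in>V. d u - D) \<le> (\<Sum>u\<in>V. d u * L u)" by (intro sum_mono)
      moreover have "(\<Sum>u\<in>V. d u - D) = 0"
        using n_pos by (simp add: sum_subtractf D_def flip: s_def)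
      ultimately show ?thesis by simp
    qed
    \<comment> \<open>Stationarity: averaging over one step of the random walk does not change a \<open>d\<close>-weighted sum.\<close>
    have Y_mean: "0 \<le> (\<Sum>u\<in>V. d u * Y i u)" for i
    proof (induction i)
      case 0
      show ?case by (simp add: Y_0)
    next
      case (Suc i)
      have "(\<Sum>u\<in>V. d u * Y (Suc i) u) = (\<Sum>u\<in>V. \<Sum>v\<in>V. K u v * (L v + Y i v))"
        by (simp add: Y_Suc)
      also have "\<dots> = (\<Sum>v\<in>V. \<Sum>u\<in>V. K v u * (L v + Y i v))"
        by (subst sum.swap) (simp add: sym)
      also have "\<dots> = (\<Sum>v\<in>V. d v * L v) + (\<Sum>v\<in>V. d v * Y i v)"
        by (simp add: d_def distrib_left sum.distrib flip: sum_distrib_right)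
      finally show ?case using L_mean Suc by simp
    qed
    have "s \<le> (\<Sum>u\<in>V. d u * (1 + Y j u))"
      using Y_mean[of j] by (simp add: algebra_simps sum.distrib s_def)
    also have "\<dots> \<le> (\<Sum>u\<in>V. d u * exp (Y j u))"
      by (intro sum_mono mult_left_mono exp_ge_add_one_self d_nonneg)
    finally have "D ^ j * s \<le> D ^ j * (\<Sum>u\<in>V. d u * exp (Y j u))"
      using D_pos by (intro mult_left_mono) auto
    also have "\<dots> \<le> (\<Sum>u\<in>V. h (Suc j) u)"
      unfolding sum_distrib_left by (intro sum_mono h_ge)
    finally have "real (card V) ^ j * (D ^ j * s) \<le> real (card V) ^ j * (\<Sum>u\<in>V. h (Suc j) u)"
      by (intro mult_left_mono) auto
    then show ?thesis using n_pos by (simp add: D_def power_divide mult_ac)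
  qed
  then show ?thesis by (simp add: s_def d_def h_def)
qed

section \<open>Walks and paths as vertex sequences\<close>

definition walks :: "'a graph \<Rightarrow> nat \<Rightarrow> 'a list set" where
  "walks G j = {xs. length xs = j \<and> set xs \<subseteq> verts G \<and>
     successively (\<lambda>u v. {u, v} \<in> edges G) xs}"

definition paths :: "'a graph \<Rightarrow> nat \<Rightarrow> 'a list set" where
  "paths G j = {xs \<in> walks G j. distinct xs}"

definition nbrs :: "'a graph \<Rightarrow> 'a \<Rightarrow> 'a set" where
  "nbrs G v = {u. {u, v} \<in> edges G}"

lemma simple_graph_edgeD:
  assumes "simple_graph G" "{u, v} \<in> edges G"
  shows "u \<noteq> v" "u \<in> verts G" "v \<in> verts G"
proof -
  have "{u, v} \<subseteq> verts G" "card {u, v} = 2"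
    using assms by (auto simp: simple_graph_def)
  then show "u \<noteq> v" "u \<in> verts G" "v \<in> verts G" by auto
qed

lemma finite_walks: "simple_graph G \<Longrightarrow> finite (walks G j)"
  by (rule finite_subset[OF _ finite_lists_length_eq[of "verts G" j]])
    (auto simp: walks_def simple_graph_def)

lemma finite_paths: "simple_graph G \<Longrightarrow> finite (paths G j)"
  by (simp add: paths_def finite_walks)

lemma finite_nbrs: "simple_graph G \<Longrightarrow> finite (nbrs G v)"
  by (rule finite_subset[of _ "verts G"])
    (auto simp: nbrs_def simple_graph_def)

lemma rev_in_paths: "xs \<in> paths G j \<Longrightarrow> rev xs \<in> paths G j"
  by (auto simp: paths_def walks_def successively_rev insert_commute)

section \<open>Copies of a path and their vertex sequences\<close>

definition path_edges :: "'a list \<Rightarrow> 'a set set" where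
  "path_edges xs = {{xs ! i, xs ! Suc i} |i. Suc i < length xs}"

definition list_graph :: "'a list \<Rightarrow> 'a graph" where
  "list_graph xs = (set xs, path_edges xs)"

lemma path_edges_rev: "path_edges (rev xs) = path_edges xs"
proof -
  have "path_edges (rev xs) \<subseteq> path_edges xs" for xs :: "'a list"
  proof
    fix e assume "e \<in> path_edges (rev xs)"
    then obtain i where i: "Suc i < length xs" "e = {rev xs ! i, rev xs ! Suc i}"
      by (auto simp: path_edges_def)
    define l where "l = length xs - Suc (Suc i)"
    have "Suc l < length xs" "rev xs ! i = xs ! Suc l" "rev xs ! Suc i = xs ! l"
      using i(1) by (auto simp: l_def rev_nth Suc_diff_Suc)
    then show "e \<in> path_edges xs" using i(2) by (auto simp: path_edges_def)
  qed
  from this[of xs] this[of "rev xs"] show ?thesis by simp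
qed

lemma path_edges_nbr:
  assumes "distinct ys" "i < length ys" "{ys ! i, x} \<in> path_edges ys"
  shows "(Suc i < length ys \<and> x = ys ! Suc i) \<or> (0 < i \<and> x = ys ! (i - 1))"
proof -
  obtain l where l: "Suc l < length ys" "{ys ! i, x} = {ys ! l, ys ! Suc l}"
    using assms(3) by (auto simp: path_edges_def)
  then consider "ys ! i = ys ! l" "x = ys ! Suc l" | "ys ! i = ys ! Suc l" "x = ys ! l"
    by (auto simp: doubleton_eq_iff)
  then show ?thesis
  proof cases
    case 1
    then have "i = l" using assms l(1) by (simp add: nth_eq_iff_index_eq)
    then show ?thesis using 1 l(1) by simp
  next
    case 2
    then have "i = Suc l" using assms l(1) by (simp add: nth_eq_iff_index_eq)
    then show ?thesis using 2 by simp
  qed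
qed

text \<open>
  Walking along both sequences from the common start, the next vertex is forced: the only other
  neighbour of the current vertex was visited one step earlier.
\<close>

lemma path_edges_eq_same_start:
  assumes dx: "distinct xs" and dy: "distinct ys" and len: "length xs = length ys"
    and edges: "path_edges xs = path_edges ys" and start: "xs ! 0 = ys ! 0"
  shows "xs = ys"
proof -
  have "xs ! i = ys ! i" if "i < length xs" for i
    using that
  proof (induction i rule: less_induct)
    case (less i)
    show ?case
    proof (cases i)
      case 0
      then show ?thesis using start by simp
    next
      case (Suc l)
      have "{xs ! l, xs ! Suc l} \<in> path_edges ys"
        using less.prems Suc by (subst edges[symmetric]) (auto simp: path_edges_def)
      moreover have xl: "xs ! l = ys ! l" using less Suc by simp
      ultimately have "xs ! Suc l = ys ! Suc l \<or> (0 < l \<and> xs ! Suc l = ys ! (l - 1))"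
        using path_edges_nbr[OF dy, of l "xs ! Suc l"] less.prems Suc len by auto
      moreover have "xs ! Suc l \<noteq> ys ! (l - 1)" if "0 < l"
      proof -
        have "ys ! (l - 1) = xs ! (l - 1)" using less.IH[of "l - 1"] less.prems Suc by simp
        then show ?thesis using dx less.prems Suc that by (simp add: nth_eq_iff_index_eq)
      qed
      ultimately show ?thesis using Suc by auto
    qed
  qed
  then show ?thesis using len by (simp add: list_eq_iff_nth_eq)
qed

text \<open>
  A path determines its two ends as the vertices with a single neighbour, so one of the two
  directions of \<open>xs\<close> starts where \<open>ys\<close> does, and the previous lemma applies.
\<close>

lemma list_graph_eq_iff:
  assumes dx: "distinct xs" and dy: "distinct ys"
    and len: "length xs = length ys" "2 \<le> length ys"
  shows "list_graph xs = list_graph ys \<longleftrightarrow> xs = ys \<or> xs = rev ys"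
proof
  assume eq: "list_graph xs = list_graph ys"
  then have sets: "set xs = set ys" and edges: "path_edges xs = path_edges ys"
    by (auto simp: list_graph_def)
  have ne: "ys \<noteq> []" using len(2) by auto
  have "ys ! 0 \<in> set xs" unfolding sets using len(2) by (intro nth_mem) linarith
  then obtain i where i: "i < length xs" "xs ! i = ys ! 0" by (auto simp: in_set_conv_nth)
  have only: "x = ys ! 1" if "{ys ! 0, x} \<in> path_edges xs" for x
    using path_edges_nbr[OF dy, of 0 x] that edges ne by auto
  \<comment> \<open>An inner vertex of \<open>xs\<close> has two neighbours, whereas the end \<open>ys ! 0\<close> has only one.\<close>
  have "i = 0 \<or> Suc i = length xs"
  proof (rule ccontr)
    assume "\<not> ?thesis"
    then obtain l where l: "i = Suc l" "Suc (Suc l) < length xs"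
      using i by (cases i) auto
    have "{xs ! i, xs ! Suc i} \<in> path_edges xs" "{xs ! i, xs ! l} \<in> path_edges xs"
      using l by (auto simp: path_edges_def insert_commute)
    then have "xs ! Suc i = ys ! 1" "xs ! l = ys ! 1"
      using only unfolding i(2) by blast+
    then have "xs ! Suc i = xs ! l" by simp
    then show False using l dx by (simp add: nth_eq_iff_index_eq)
  qed
  then show "xs = ys \<or> xs = rev ys"
  proof
    assume "i = 0"
    then show ?thesis using path_edges_eq_same_start[OF dx dy len(1) edges] i by simp
  next
    assume "Suc i = length xs"
    then have "rev xs ! 0 = ys ! 0" using i by (simp add: rev_nth flip: \<open>Suc i = length xs\<close>)
    then have "rev xs = ys"
      using path_edges_eq_same_start[of "rev xs" ys] dx dy len(1) edges
      by (simp add: path_edges_rev)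
    then show ?thesis by auto
  qed
next
  assume "xs = ys \<or> xs = rev ys"
  then show "list_graph xs = list_graph ys"
    by (auto simp: list_graph_def path_edges_rev)
qed

lemma isomorphic_path_graph_iff:
  "isomorphic (path_graph j) H \<longleftrightarrow> (\<exists>xs. length xs = j \<and> distinct xs \<and> H = list_graph xs)"
proof
  assume "isomorphic (path_graph j) H"
  then obtain f where f: "bij_betw f {..<j} (verts H)"
    "edges H = (\<lambda>e. f ` e) ` {{i, Suc i} |i. Suc i < j}"
    by (auto simp: isomorphic_def path_graph_def)
  let ?xs = "map f [0..<j]"
  have "path_edges ?xs = {f ` {i, Suc i} |i. Suc i < j}"
    by (force simp: path_edges_def)
  also have "\<dots> = edges H" unfolding f(2) by blast
  finally have "H = list_graph ?xs"
    using f(1) by (auto simp: list_graph_def bij_betw_def prod_eq_iff lessThan_atLeast0)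
  then show "\<exists>xs. length xs = j \<and> distinct xs \<and> H = list_graph xs"
    using f(1) by (intro exI[of _ ?xs])
      (auto simp: distinct_map bij_betw_def lessThan_atLeast0)
next
  assume "\<exists>xs. length xs = j \<and> distinct xs \<and> H = list_graph xs"
  then obtain xs where xs: "length xs = j" "distinct xs" "H = list_graph xs" by blast
  have "bij_betw (\<lambda>i. xs ! i) {..<j} (verts H)"
    using xs by (auto simp: list_graph_def intro: bij_betw_nth)
  moreover have "edges H = (\<lambda>e. (\<lambda>i. xs ! i) ` e) ` {{i, Suc i} |i. Suc i < j}"
  proof -
    have "(\<lambda>e. (\<lambda>i. xs ! i) ` e) ` {{i, Suc i} |i. Suc i < j}
      = {(\<lambda>i. xs ! i) ` {i, Suc i} |i. Suc i < j}" by blast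
    then show ?thesis using xs by (simp add: list_graph_def path_edges_def)
  qed
  ultimately show "isomorphic (path_graph j) H"
    by (auto simp: isomorphic_def path_graph_def)
qed

lemma subgraph_list_graph_iff:
  assumes "distinct xs" "simple_graph G"
  shows "subgraph (list_graph xs) G \<longleftrightarrow> xs \<in> paths G (length xs)"
proof -
  have "simple_graph (list_graph xs)"
    using assms(1) by (auto simp: simple_graph_def list_graph_def path_edges_def
        nth_eq_iff_index_eq card_insert_if)
  moreover have "path_edges xs \<subseteq> edges G \<longleftrightarrow> successively (\<lambda>u v. {u, v} \<in> edges G) xs"
    by (auto simp: path_edges_def successively_conv_nth)
  ultimately show ?thesis
    using assms(1) by (auto simp: subgraph_def list_graph_def paths_def walks_def)
qed

text \<open>
  The map from a path sequence to the subgraph it traces has all copies as its image, and each of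
  its fibres consists of a sequence and its reverse. These differ because there are at least two
  vertices; for a single vertex the factor would be 1.
\<close>

lemma card_paths_eq_num_copies:
  assumes "simple_graph G" "2 \<le> j"
  shows "card (paths G j) = 2 * num_copies (path_graph j) G"
proof -
  let ?C = "{H. subgraph H G \<and> isomorphic (path_graph j) H}"
  have copies: "?C = list_graph ` paths G j"
  proof -
    have "paths G j = {xs. length xs = j \<and> distinct xs \<and> subgraph (list_graph xs) G}"
    proof (rule set_eqI)
      fix xs
      show "xs \<in> paths G j
          \<longleftrightarrow> xs \<in> {xs. length xs = j \<and> distinct xs \<and> subgraph (list_graph xs) G}"
      proof (cases "distinct xs \<and> length xs = j")
        case True
        then show ?thesis using subgraph_list_graph_iff[of xs G] assms(1) by simp
      next
        case False
        then show ?thesis by (auto simp: paths_def walks_def)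
      qed
    qed
    then show ?thesis by (auto simp: isomorphic_path_graph_iff)
  qed
  have fibre: "card {xs \<in> paths G j. list_graph xs = H} = 2" if H: "H \<in> list_graph ` paths G j" for H
  proof -
    obtain ys where ys: "ys \<in> paths G j" "H = list_graph ys" using H by blast
    then have dy: "distinct ys" "length ys = j" by (auto simp: paths_def walks_def)
    have "{xs \<in> paths G j. list_graph xs = H} = {ys, rev ys}"
    proof -
      have "xs \<in> paths G j \<Longrightarrow> list_graph xs = list_graph ys \<longleftrightarrow> xs = ys \<or> xs = rev ys" for xs
        using dy assms(2) by (intro list_graph_eq_iff) (auto simp: paths_def walks_def)
      then show ?thesis using ys rev_in_paths[OF ys(1)] by auto
    qed
    moreover have "ys \<noteq> rev ys"
    proof
      assume "ys = rev ys"
      then have "ys ! 0 = rev ys ! 0" by simp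
      then have "ys ! 0 = ys ! (length ys - 1)" using dy assms(2) by (simp add: rev_nth)
      then show False using dy assms(2) by (simp add: nth_eq_iff_index_eq)
    qed
    ultimately show ?thesis by simp
  qed
  have "card (paths G j) = (\<Sum>H\<in>list_graph ` paths G j. card {xs \<in> paths G j. list_graph xs = H})"
    using sum.image_gen[OF finite_paths[OF assms(1)], of "\<lambda>_. 1::nat" j list_graph] by simp
  also have "\<dots> = 2 * card (list_graph ` paths G j)" by (simp add: fibre)
  finally show ?thesis by (simp add: num_copies_def copies)
qed

section \<open>Counting walks and paths through degrees\<close>

lemma card_Cons:
  assumes "finite S" "\<And>ys. ys \<in> S \<Longrightarrow> finite (C ys)"
  shows "card {x # ys |x ys. ys \<in> S \<and> x \<in> C ys} = (\<Sum>ys\<in>S. card (C ys))"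
proof -
  have "{x # ys |x ys. ys \<in> S \<and> x \<in> C ys} = (\<lambda>(ys, x). x # ys) ` Sigma S C" by auto
  then have "card {x # ys |x ys. ys \<in> S \<and> x \<in> C ys} = card (Sigma S C)"
    by (simp add: card_image inj_on_def)
  then show ?thesis using assms by simp
qed

lemma walks_Suc:
  "walks G (Suc (Suc j)) = {x # ys |x ys. ys \<in> walks G (Suc j) \<and> x \<in> nbrs G (hd ys) \<inter> verts G}"
proof (intro set_eqI iffI)
  fix xs assume "xs \<in> walks G (Suc (Suc j))"
  then show "xs \<in> {x # ys |x ys. ys \<in> walks G (Suc j) \<and> x \<in> nbrs G (hd ys) \<inter> verts G}"
    by (cases xs) (auto simp: walks_def nbrs_def successively_Cons)
next
  fix xs assume "xs \<in> {x # ys |x ys. ys \<in> walks G (Suc j) \<and> x \<in> nbrs G (hd ys) \<inter> verts G}"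
  then show "xs \<in> walks G (Suc (Suc j))"
    by (auto simp: walks_def nbrs_def successively_Cons)
qed

lemma paths_Suc:
  "paths G (Suc (Suc j))
    = {x # ys |x ys. ys \<in> paths G (Suc j) \<and> x \<in> (nbrs G (hd ys) \<inter> verts G) - set ys}"
  unfolding paths_def walks_Suc by auto

lemma walks_1: "walks G (Suc 0) = (\<lambda>v. [v]) ` verts G"
  by (auto simp: walks_def length_Suc_conv)

lemma nbrs_subset_verts: "simple_graph G \<Longrightarrow> nbrs G v \<subseteq> verts G"
  by (auto simp: nbrs_def dest: simple_graph_edgeD(2))

lemma hd_in_verts: "ys \<in> walks G (Suc j) \<Longrightarrow> hd ys \<in> verts G"
  by (cases ys) (auto simp: walks_def)

lemma card_walks_le:
  assumes G: "simple_graph G" and deg: "\<And>v. v \<in> verts G \<Longrightarrow> card (nbrs G v) \<le> D"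
  shows "card (walks G (Suc j)) \<le> card (verts G) * D ^ j"
proof (induction j)
  case 0
  show ?case by (simp add: walks_1 card_image inj_on_def)
next
  case (Suc j)
  have "card (walks G (Suc (Suc j))) = (\<Sum>ys\<in>walks G (Suc j). card (nbrs G (hd ys) \<inter> verts G))"
    unfolding walks_Suc by (rule card_Cons) (simp_all add: finite_walks finite_nbrs G)
  also have "\<dots> \<le> (\<Sum>ys\<in>walks G (Suc j). D)"
    using nbrs_subset_verts[OF G]
    by (intro sum_mono) (simp add: Int_absorb2 deg hd_in_verts)
  also have "\<dots> = card (walks G (Suc j)) * D" by simp
  also have "\<dots> \<le> card (verts G) * D ^ j * D" by (rule mult_le_mono1[OF Suc])
  finally show ?case by (simp add: mult_ac)
qed

text \<open>
  A path is extended greedily at its head. The \<open>i + 1\<close> vertices used so far include the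
  head, which is not its own neighbour, so at most \<open>i\<close> of its neighbours are excluded. This makes
  the bound exact for complete graphs; truncated subtraction makes the product vanish once the degrees
  are exhausted.
\<close>

lemma card_paths_ge:
  assumes G: "simple_graph G" and deg: "\<And>v. v \<in> verts G \<Longrightarrow> \<delta> \<le> card (nbrs G v)"
  shows "card (verts G) * (\<Prod>i<j. \<delta> - i) \<le> card (paths G (Suc j))"
proof (induction j)
  case 0
  have "paths G (Suc 0) = walks G (Suc 0)" by (auto simp: paths_def walks_1)
  then show ?case by (simp add: walks_1 card_image inj_on_def)
next
  case (Suc j)
  have new: "\<delta> - j \<le> card ((nbrs G (hd ys) \<inter> verts G) - set ys)" if "ys \<in> paths G (Suc j)" for ys
  proof -
    have ys: "ys \<in> walks G (Suc j)" "length ys = Suc j" "ys \<noteq> []"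
      using that by (auto simp: paths_def walks_def)
    have eq: "(nbrs G (hd ys) \<inter> verts G) - set ys = nbrs G (hd ys) - (set ys - {hd ys})"
    proof -
      have "hd ys \<notin> nbrs G (hd ys)"
        using simple_graph_edgeD(1)[OF G, of "hd ys" "hd ys"] by (auto simp: nbrs_def)
      moreover have "nbrs G (hd ys) \<inter> verts G = nbrs G (hd ys)"
        using nbrs_subset_verts[OF G] by blast
      moreover have "hd ys \<in> set ys" using ys(3) by simp
      ultimately show ?thesis by auto
    qed
    have "card (set ys - {hd ys}) \<le> j"
      using ys card_length[of ys] by simp
    then have "\<delta> - j \<le> card (nbrs G (hd ys)) - card (set ys - {hd ys})"
      using deg[OF hd_in_verts[OF ys(1)]] by linarith
    also have "\<dots> \<le> card (nbrs G (hd ys) - (set ys - {hd ys}))"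
      by (intro diff_card_le_card_Diff) simp
    finally show ?thesis using eq by simp
  qed
  have "card (verts G) * (\<Prod>i<Suc j. \<delta> - i) \<le> card (paths G (Suc j)) * (\<delta> - j)"
    using mult_le_mono1[OF Suc, of "\<delta> - j"] by (simp add: mult_ac)
  also have "\<dots> = (\<Sum>ys\<in>paths G (Suc j). \<delta> - j)" by simp
  also have "\<dots> \<le> (\<Sum>ys\<in>paths G (Suc j). card ((nbrs G (hd ys) \<inter> verts G) - set ys))"
    by (intro sum_mono new)
  also have "\<dots> = card (paths G (Suc (Suc j)))"
    unfolding paths_Suc by (rule card_Cons[symmetric]) (simp_all add: finite_paths finite_nbrs G)
  finally show ?case .
qed

text \<open>
  The complete graph has the most paths. The right-hand side is its count in the shape produced by
  \<open>card_paths_ge\<close>, so that the two bounds can be compared directly.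
\<close>

lemma card_paths_le_falling:
  assumes G: "simple_graph G"
  shows "card (paths G (Suc j)) \<le> card (verts G) * (\<Prod>i<j. card (verts G) - 1 - i)"
proof -
  let ?n = "card (verts G)"
  let ?L = "{xs. length xs = Suc j \<and> distinct xs \<and> set xs \<subseteq> verts G}"
  have fin: "finite (verts G)" using G by (simp add: simple_graph_def)
  have "finite ?L"
    by (rule finite_subset[OF _ finite_lists_length_eq[OF fin, of "Suc j"]]) auto
  then have le: "card (paths G (Suc j)) \<le> card ?L"
    by (rule card_mono) (auto simp: paths_def walks_def)
  show ?thesis
  proof (cases "Suc j \<le> ?n")
    case True
    then have "card ?L = \<Prod>{?n - Suc j + 1..?n}"
      by (rule card_lists_distinct_length_eq[OF fin])
    also have "\<dots> = (\<Prod>i<Suc j. ?n - i)"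
      using True by (intro prod.reindex_bij_witness[of _ "\<lambda>i. ?n - i" "\<lambda>i. ?n - i"]) auto
    also have "\<dots> = ?n * (\<Prod>i<j. ?n - 1 - i)"
      by (subst prod.lessThan_Suc_shift) simp
    finally show ?thesis using le by simp
  next
    case False
    have "xs \<notin> ?L" for xs
    proof
      assume xs: "xs \<in> ?L"
      then have "Suc j = card (set xs)" by (auto simp: distinct_card)
      also have "\<dots> \<le> ?n" using xs fin by (intro card_mono) auto
      finally show False using False by simp
    qed
    then have empty: "?L = {}" by blast
    show ?thesis using le unfolding empty by simp
  qed
qed

text \<open>
  At least \<open>(n - t)\<^sup>t\<close> of the \<open>n\<^sup>t\<close> vertex sequences are free of repetitions, so by
  Bernoulli's inequality at most \<open>t\<^sup>2 n\<^bsup>t-1\<^esup>\<close> have one.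
\<close>

lemma card_walks_le_paths:
  assumes G: "simple_graph G" and t: "1 \<le> t" "t \<le> card (verts G)"
  shows "real (card (walks G t)) \<le> real (card (paths G t)) + real t ^ 2 * real (card (verts G)) ^ (t - 1)"
proof -
  let ?V = "verts G" and ?n = "card (verts G)"
  let ?A = "{xs. set xs \<subseteq> ?V \<and> length xs = t}"
  let ?L = "{xs. length xs = t \<and> distinct xs \<and> set xs \<subseteq> ?V}"
  have fin: "finite ?V" using G by (simp add: simple_graph_def)
  have n: "0 < real ?n" using t by simp
  have finA: "finite ?A" by (rule finite_lists_length_eq[OF fin])
  have LA: "?L \<subseteq> ?A" by auto
  have cardA: "card ?A = ?n ^ t" by (rule card_lists_length_eq[OF fin])
  have "(?n - t) ^ t \<le> \<Prod>{?n - t + 1..?n}"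
  proof -
    have "(?n - t) ^ t = (\<Prod>i\<in>{?n - t + 1..?n}. ?n - t)" using t by simp
    also have "\<dots> \<le> \<Prod>{?n - t + 1..?n}" by (intro prod_mono) auto
    finally show ?thesis .
  qed
  also have "\<dots> = card ?L"
    by (rule card_lists_distinct_length_eq[OF fin t(2), symmetric])
  finally have "real ((?n - t) ^ t) \<le> real (card ?L)" by (simp only: of_nat_le_iff)
  then have L: "(real ?n - real t) ^ t \<le> real (card ?L)" using t by (simp add: of_nat_diff)
  have "1 + real t * (- real t / real ?n) \<le> (1 + (- real t / real ?n)) ^ t"
    using t n by (intro Bernoulli_inequality) (simp add: field_simps)
  then have "real ?n ^ t * (1 + real t * (- real t / real ?n))
      \<le> real ?n ^ t * (1 + (- real t / real ?n)) ^ t"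
    by (intro mult_left_mono) auto
  also have "\<dots> = (real ?n - real t) ^ t"
    using n by (simp add: field_simps flip: power_mult_distrib)
  also note L
  finally have "real ?n ^ t * (1 + real t * (- real t / real ?n)) \<le> real (card ?L)" .
  moreover have "real ?n ^ t * (1 + real t * (- real t / real ?n))
      = real ?n ^ t - real t ^ 2 * real ?n ^ (t - 1)"
    using n t by (cases t) (simp_all add: field_simps power2_eq_square)
  ultimately have *: "real ?n ^ t - real (card ?L) \<le> real t ^ 2 * real ?n ^ (t - 1)" by simp
  have "walks G t \<subseteq> paths G t \<union> (?A - ?L)" by (auto simp: paths_def walks_def)
  then have "card (walks G t) \<le> card (paths G t \<union> (?A - ?L))"
    using finA by (intro card_mono) (auto simp: finite_paths G)
  also have "\<dots> \<le> card (paths G t) + card (?A - ?L)" by (rule card_Un_le)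
  finally have "real (card (walks G t)) \<le> real (card (paths G t)) + real (card (?A - ?L))" by simp
  moreover have "real (card (?A - ?L)) = real ?n ^ t - real (card ?L)"
    using card_Diff_subset[OF finite_subset[OF LA finA] LA] card_mono[OF finA LA]
    by (simp add: cardA of_nat_diff)
  ultimately show ?thesis using * by simp
qed

section \<open>Chains of paths are walks\<close>

definition path_kernel :: "'a graph \<Rightarrow> nat \<Rightarrow> 'a \<Rightarrow> 'a \<Rightarrow> real" where
  "path_kernel G k u v = real (card {p \<in> paths G k. hd p = u \<and> last p = v})"

lemma path_kernel_sym: "path_kernel G k u v = path_kernel G k v u"
proof -
  have "bij_betw rev {p \<in> paths G k. hd p = u \<and> last p = v} {p \<in> paths G k. hd p = v \<and> last p = u}"
    by (rule bij_betw_byWitness[where f' = rev]) (auto simp: rev_in_paths hd_rev last_rev)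
  then show ?thesis by (simp add: path_kernel_def bij_betw_same_card)
qed

lemma sum_path_kernel:
  assumes G: "simple_graph G" and k: "1 \<le> k"
  shows "(\<Sum>u\<in>verts G. \<Sum>v\<in>verts G. path_kernel G k u v) = real (card (paths G k))"
proof -
  have fin: "finite (verts G)" using G by (simp add: simple_graph_def)
  have ends: "(\<lambda>p. (hd p, last p)) ` paths G k \<subseteq> verts G \<times> verts G"
  proof -
    have "hd p \<in> verts G \<and> last p \<in> verts G" if "p \<in> paths G k" for p
    proof -
      have "p \<noteq> []" "set p \<subseteq> verts G" using that k by (auto simp: paths_def walks_def)
      then show ?thesis by auto
    qed
    then show ?thesis by auto
  qed
  have "real (card (paths G k))
      = (\<Sum>z\<in>verts G \<times> verts G. \<Sum>p\<in>{p \<in> paths G k. (hd p, last p) = z}. 1)"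
    using sum.group[OF finite_paths[OF G] finite_cartesian_product[OF fin fin] ends,
        of "\<lambda>_. 1 :: real"] by simp
  also have "\<dots> = (\<Sum>(u, v)\<in>verts G \<times> verts G. path_kernel G k u v)"
    by (intro sum.cong refl) (auto simp: path_kernel_def)
  finally show ?thesis by (simp add: sum.cartesian_product)
qed

text \<open>
  A path from \<open>u\<close> to \<open>v\<close> followed by a walk from \<open>v\<close> is a walk from \<open>u\<close>, and since the length
  of the path is fixed, both pieces can be recovered from the concatenation.
\<close>

lemma path_kernel_walks:
  assumes G: "simple_graph G" and k: "1 \<le> k"
  shows "(\<Sum>v\<in>verts G. path_kernel G k u v * real (card {w \<in> walks G (Suc j). hd w = v}))
    \<le> real (card {w \<in> walks G (Suc (k - 1 + j)). hd w = u})"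
proof -
  let ?P = "\<lambda>v. {p \<in> paths G k. hd p = u \<and> last p = v}"
  let ?W = "\<lambda>v. {w \<in> walks G (Suc j). hd w = v}"
  let ?S = "SIGMA v:verts G. ?P v \<times> ?W v"
  let ?join = "\<lambda>(v, p, w). p @ tl w"
  have fin: "finite (verts G)" using G by (simp add: simple_graph_def)
  have "inj_on ?join ?S"
  proof (rule inj_onI)
    fix x y assume x: "x \<in> ?S" and y: "y \<in> ?S" and eq: "?join x = ?join y"
    obtain v p w v' p' w' where xy: "x = (v, p, w)" "y = (v', p', w')"
      by (cases x, cases y) auto
    have len: "length p = length p'" using x y xy by (auto simp: paths_def walks_def)
    then have pp: "p = p'" "tl w = tl w'" using eq xy by auto
    then have "v = v'" using x y xy by auto
    moreover have "w \<noteq> []" "w' \<noteq> []" "hd w = v" "hd w' = v'"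
      using x y xy by (auto simp: walks_def)
    ultimately have "w = w'" using pp by (metis list.collapse)
    then show "x = y" using xy pp \<open>v = v'\<close> by simp
  qed
  moreover have "?join ` ?S \<subseteq> {w \<in> walks G (Suc (k - 1 + j)). hd w = u}"
  proof
    fix z assume "z \<in> ?join ` ?S"
    then obtain p w where p: "p \<in> paths G k" "hd p = u" and w: "w \<in> walks G (Suc j)"
      and hw: "hd w = last p" and z: "z = p @ tl w" by auto
    obtain x w' where w': "w = x # w'" using w by (cases w) (auto simp: walks_def)
    have "p \<noteq> []" using p k by (auto simp: paths_def walks_def)
    then show "z \<in> {w \<in> walks G (Suc (k - 1 + j)). hd w = u}"
      using p w hw z w' k
      by (auto simp: paths_def walks_def successively_append_iff successively_Cons)
  qed
  moreover have "finite {w \<in> walks G (Suc (k - 1 + j)). hd w = u}"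
    using finite_walks[OF G] by simp
  ultimately have "card ?S \<le> card {w \<in> walks G (Suc (k - 1 + j)). hd w = u}"
    by (rule card_inj_on_le)
  moreover have "card ?S = (\<Sum>v\<in>verts G. card (?P v) * card (?W v))"
    using fin finite_paths[OF G, of k] finite_walks[OF G, of "Suc j"]
    by (subst card_SigmaI) (auto simp: card_cartesian_product)
  ultimately have "(\<Sum>v\<in>verts G. card (?P v) * card (?W v))
      \<le> card {w \<in> walks G (Suc (k - 1 + j)). hd w = u}" by simp
  then have "real (\<Sum>v\<in>verts G. card (?P v) * card (?W v))
      \<le> real (card {w \<in> walks G (Suc (k - 1 + j)). hd w = u})" by (simp only: of_nat_le_iff)
  then show ?thesis by (simp add: path_kernel_def)
qed

lemma kernel_op_iterate_le_walks:
  assumes G: "simple_graph G" and k: "1 \<le> k" and "u \<in> verts G"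
  shows "(kernel_op (verts G) (path_kernel G k) ^^ q) (\<lambda>_. 1) u
    \<le> real (card {w \<in> walks G (Suc (q * (k - 1))). hd w = u})"
  using \<open>u \<in> verts G\<close>
proof (induction q arbitrary: u)
  case 0
  then have "{w \<in> walks G (Suc 0). hd w = u} = {[u]}" by (auto simp: walks_1)
  then show ?case by simp
next
  case (Suc q)
  have "(kernel_op (verts G) (path_kernel G k) ^^ Suc q) (\<lambda>_. 1) u
      \<le> (\<Sum>v\<in>verts G. path_kernel G k u v * real (card {w \<in> walks G (Suc (q * (k - 1))). hd w = v}))"
    unfolding funpow.simps comp_apply kernel_op_def[of _ _ _ u]
    by (intro sum_mono mult_left_mono Suc.IH) (simp_all add: path_kernel_def)
  also note path_kernel_walks[OF G k]
  finally show ?case by simp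
qed

text \<open>
  The Blakley--Roy inequality for the kernel of \<open>k\<close>-vertex paths, whose total weight is the number
  of path sequences. Counting paths instead of walks in the kernel gives the power of the path number
  on the left without a further error term.
\<close>

lemma card_paths_power_le:
  assumes G: "simple_graph G" and k: "1 \<le> k" and q: "1 \<le> q"
  shows "real (card (paths G k)) ^ q
    \<le> real (card (verts G)) ^ (q - 1) * real (card (walks G (Suc (q * (k - 1)))))"
proof -
  let ?V = "verts G" and ?W = "walks G (Suc (q * (k - 1)))"
  have fin: "finite ?V" using G by (simp add: simple_graph_def)
  have "real (card (paths G k)) ^ q
      \<le> real (card ?V) ^ (q - 1) * (\<Sum>u\<in>?V. (kernel_op ?V (path_kernel G k) ^^ q) (\<lambda>_. 1) u)"
    using blakley_roy[OF fin, of "path_kernel G k" "q - 1"] q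
    by (simp add: path_kernel_sym sum_path_kernel[OF G k]) (simp add: path_kernel_def)
  also have "\<dots> \<le> real (card ?V) ^ (q - 1) * (\<Sum>u\<in>?V. real (card {w \<in> ?W. hd w = u}))"
    by (intro mult_left_mono sum_mono kernel_op_iterate_le_walks G k) auto
  also have "(\<Sum>u\<in>?V. real (card {w \<in> ?W. hd w = u})) = real (card ?W)"
    using sum.group[OF finite_walks[OF G] fin, of hd "Suc (q * (k - 1))" "\<lambda>_. 1 :: real"]
      hd_in_verts by fastforce
  finally show ?thesis .
qed

section \<open>Almost regular graphs with few long paths\<close>

text \<open>
  A Cayley sum graph of the integers modulo \<open>n\<close>. The condition is symmetric in \<open>u\<close> and \<open>v\<close>, so
  every \<open>s \<le> n\<close> is possible, irrespective of parity; the price is that a vertex with \<open>2 v mod n < s\<close>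
  loses one neighbour to the excluded loop.
\<close>

definition sum_graph :: "nat \<Rightarrow> nat \<Rightarrow> nat graph" where
  "sum_graph n s = ({..<n}, {{u, v} |u v. u < n \<and> v < n \<and> u \<noteq> v \<and> (u + v) mod n < s})"

lemma simple_sum_graph: "simple_graph (sum_graph n s)"
  by (auto simp: simple_graph_def sum_graph_def)

lemma verts_sum_graph: "verts (sum_graph n s) = {..<n}"
  by (simp add: sum_graph_def)

lemma nbrs_sum_graph:
  assumes "v < n"
  shows "nbrs (sum_graph n s) v = {u \<in> {..<n}. (v + u) mod n < s} - {v}"
  using assms by (auto simp: nbrs_def sum_graph_def doubleton_eq_iff add.commute)

text \<open>
  Translation by \<open>v\<close> permutes the residues, so exactly \<open>s\<close> of them are sent below \<open>s\<close>; one of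
  these may be \<open>v\<close> itself.
\<close>

lemma degree_sum_graph:
  assumes v: "v < n" and s: "s \<le> n"
  shows "s - 1 \<le> card (nbrs (sum_graph n s) v)" "card (nbrs (sum_graph n s) v) \<le> s"
proof -
  let ?f = "\<lambda>u. (v + u) mod n"
  let ?N = "{u \<in> {..<n}. ?f u < s}"
  have inj: "inj_on ?f {..<n}"
  proof (rule inj_onI)
    have f: "?f u = (if v + u < n then v + u else v + u - n)" if "u < n" for u
      using that v by (simp add: mod_if)
    fix x y assume "x \<in> {..<n}" "y \<in> {..<n}" "?f x = ?f y"
    then show "x = y" using f[of x] f[of y] v by (auto split: if_splits)
  qed
  have "?f ` {..<n} = {..<n}"
    using v by (intro endo_inj_surj inj) auto
  then have "?f ` ?N = {..<s}"
    using s by (auto simp: image_iff set_eq_iff) (metis lessThan_iff order_less_le_trans)+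
  moreover have "inj_on ?f ?N" using inj by (rule inj_on_subset) auto
  ultimately have "card ?N = s" using card_image by fastforce
  then show "s - 1 \<le> card (nbrs (sum_graph n s) v)" "card (nbrs (sum_graph n s) v) \<le> s"
    using v by (auto simp: nbrs_sum_graph card_Diff_singleton_if)
qed

text \<open>
  The graph is the sum graph for the least \<open>s\<close> at which the greedy bound on path sequences
  reaches \<open>2 m\<close>. A suitable \<open>s\<close> exists because at \<open>s = n\<close> the bound is the count in the complete
  graph, and minimality bounds \<open>s\<close> from above.
\<close>

lemma exists_graph_few_paths:
  assumes k: "2 \<le> k" and m: "0 < m"
    and ne: "satex_graphs n (path_graph k) m \<noteq> {}" and t: "2 \<le> t"
  shows "\<exists>H\<in>satex_graphs n (path_graph k) m.
    2 * real (num_copies (path_graph t) H)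
      \<le> real n * (real k + root (k - 1) (2 * real m / real n)) ^ (t - 1)"
proof -
  define j where "j = k - 1"
  have kj: "k = Suc j" "0 < j" using k by (auto simp: j_def)
  define c where "c s = n * (\<Prod>i<j. s - 1 - i)" for s
  obtain H0 :: "nat graph" where H0: "simple_graph H0" "card (verts H0) = n" "m \<le> num_copies (path_graph k) H0"
    using ne unfolding satex_graphs_def by blast
  have "2 * m \<le> card (paths H0 k)"
    using H0 card_paths_eq_num_copies[of H0 k] k by simp
  also have "\<dots> \<le> c n"
    using card_paths_le_falling[OF H0(1), of j] H0(2) by (simp add: kj c_def)
  finally have c_n: "2 * m \<le> c n" .
  define s where "s = (LEAST s. 2 * m \<le> c s)"
  have s: "2 * m \<le> c s" unfolding s_def by (rule LeastI[of _ n]) (rule c_n)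
  have s_le: "s \<le> n" unfolding s_def by (rule Least_le) (rule c_n)
  have n: "0 < n" using c_n m by (cases n) (auto simp: c_def)
  have c0: "c 0 = 0" using kj by (auto simp: c_def)
  then have "s \<noteq> 0" using s m by (cases "s = 0") auto
  then obtain r where r: "s = Suc r" by (cases s) auto
  have "\<not> 2 * m \<le> c r" using not_less_Least[of r "\<lambda>s. 2 * m \<le> c s"] r by (simp add: s_def)
  then have cr: "real (c r) < 2 * real m" by linarith
  define z where "z = root j (2 * real m / real n)"
  have z: "0 \<le> z" "z ^ j = 2 * real m / real n"
    using kj by (simp_all add: z_def)
  have s_z: "real s \<le> real k + z"
  proof (cases "s \<le> k")
    case True
    then show ?thesis using z by simp
  next
    case False
    \<comment> \<open>With \<open>r = s - 1\<close>, the smallest of the \<open>j = k - 1\<close> factors of the product in \<open>c r\<close> is \<open>r - j = s - k\<close>.\<close>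
    have "(s - k) ^ j = (\<Prod>i<j. s - k)" by simp
    also have "\<dots> \<le> (\<Prod>i<j. r - 1 - i)"
      using kj r by (intro prod_mono) auto
    finally have "real (n * (s - k) ^ j) \<le> real (c r)" by (simp only: c_def mult_le_mono2 of_nat_le_iff)
    then have "real n * real (s - k) ^ j \<le> real (c r)" by simp
    also note cr
    also have "2 * real m = real n * z ^ j" using n z(2) by simp
    finally have "real (s - k) ^ j < z ^ j" using n by simp
    then have "real (s - k) < z" by (rule power_less_imp_less_base) (rule z)
    then show ?thesis using False by (simp add: of_nat_diff)
  qed
  let ?H = "sum_graph n s"
  have cv: "card (verts ?H) = n" by (simp add: verts_sum_graph)
  have "2 * m \<le> card (paths ?H k)"
    using card_paths_ge[OF simple_sum_graph, of n s "s - 1" j] degree_sum_graph(1)[OF _ s_le] s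
    by (simp add: kj c_def verts_sum_graph)
  then have "m \<le> num_copies (path_graph k) ?H"
    using card_paths_eq_num_copies[OF simple_sum_graph k, of n s] by simp
  then have "?H \<in> satex_graphs n (path_graph k) m"
    by (simp add: satex_graphs_def simple_sum_graph cv)
  moreover have "2 * real (num_copies (path_graph t) ?H) \<le> real n * (real k + z) ^ (t - 1)"
  proof -
    have "2 * num_copies (path_graph t) ?H = card (paths ?H t)"
      using card_paths_eq_num_copies[OF simple_sum_graph t, of n s] by simp
    also have "\<dots> \<le> card (walks ?H t)"
      by (intro card_mono finite_walks simple_sum_graph) (auto simp: paths_def)
    also have "\<dots> \<le> n * s ^ (t - 1)"
      using card_walks_le[OF simple_sum_graph, of n s s "t - 1"] degree_sum_graph(2)[OF _ s_le] t
      by (simp add: verts_sum_graph)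
    finally have "real (2 * num_copies (path_graph t) ?H) \<le> real (n * s ^ (t - 1))"
      by (simp only: of_nat_le_iff)
    then have "2 * real (num_copies (path_graph t) ?H) \<le> real n * real s ^ (t - 1)" by simp
    also have "\<dots> \<le> real n * (real k + z) ^ (t - 1)"
      by (intro mult_left_mono power_mono s_z) auto
    finally show ?thesis .
  qed
  ultimately show ?thesis by (auto simp: z_def j_def)
qed

lemma num_copies_path_ge:
  assumes H: "H \<in> satex_graphs n (path_graph k) m" and k: "2 \<le> k" and q: "1 \<le> q"
    and t: "t = q * (k - 1) + 1" "t \<le> n"
  shows "(2 * real m) ^ q / real n ^ (q - 1) - real t ^ 2 * real n ^ (t - 1)
    \<le> 2 * real (num_copies (path_graph t) H)"
proof -
  have G: "simple_graph H" "card (verts H) = n" "m \<le> num_copies (path_graph k) H"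
    using H by (auto simp: satex_graphs_def)
  have t2: "2 \<le> t" using k q t by (cases q; cases k) auto
  have n: "0 < real n" using t t2 by simp
  have "2 * real m \<le> real (card (paths H k))"
    using G card_paths_eq_num_copies[OF G(1) k] by simp
  then have "(2 * real m) ^ q \<le> real (card (paths H k)) ^ q" by (intro power_mono) auto
  also have "\<dots> \<le> real n ^ (q - 1) * real (card (walks H t))"
    using card_paths_power_le[OF G(1), of k q] k q G(2) t by simp
  finally have "(2 * real m) ^ q / real n ^ (q - 1) \<le> real (card (walks H t))"
    using n by (simp add: field_simps)
  also have "\<dots> \<le> real (card (paths H t)) + real t ^ 2 * real n ^ (t - 1)"
    using card_walks_le_paths[OF G(1), of t] t(2) t2 unfolding G(2) by simp
  also have "real (card (paths H t)) = 2 * real (num_copies (path_graph t) H)"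
    using card_paths_eq_num_copies[OF G(1) t2] by simp
  finally show ?thesis by simp
qed

section \<open>The asymptotic formula\<close>

theorem theorem5p4:
  fixes k q t :: nat and m :: "nat \<Rightarrow> nat"
  assumes "k \<ge> 2" and "q > 1" and "t = q * (k - 1) + 1"
    and "filterlim (\<lambda>n. real (m n) / real n powr (real k - 1 / real q)) at_top sequentially"
  shows "\<exists>\<epsilon> :: nat \<Rightarrow> real. \<epsilon> \<longlonglongrightarrow> 0 \<and>
    (\<forall>\<^sub>F n in sequentially. satex_graphs n (path_graph k) (m n) \<noteq> {} \<longrightarrow>
       real (satex n (path_graph k) (m n) (path_graph t)) =
         (1 / 2 + \<epsilon> n) * ((2 * real (m n)) ^ q / real n ^ (q - 1)))"
proof -
  define r where "r n = real (m n) / real n powr (real k - 1 / real q)" for n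
  have r: "filterlim r at_top sequentially" using assms(4) by (simp add: r_def[abs_def])
  define X where "X n = (2 * real (m n)) ^ q / real n ^ (q - 1)" for n
  define z where "z n = root (k - 1) (2 * real (m n) / real n)" for n
  define S where "S n = satex_graphs n (path_graph k) (m n)" for n
  define sx where "sx n = real (satex n (path_graph k) (m n) (path_graph t))" for n
  define \<epsilon> where "\<epsilon> n = (if S n = {} then 0 else sx n / X n - 1 / 2)" for n
  have t2: "2 \<le> t" using assms(1-3) by (cases q; cases k) auto
  have ev_n: "\<forall>\<^sub>F n in sequentially. t \<le> n" by (rule eventually_ge_at_top)
  have ev_r: "\<forall>\<^sub>F n in sequentially. 1 \<le> r n" using r by (simp add: filterlim_at_top)
  have ev_m: "\<forall>\<^sub>F n in sequentially. 0 < m n \<and> t \<le> n"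
    using ev_r ev_n
  proof eventually_elim
    case (elim n)
    then show ?case by (cases "m n") (auto simp: r_def)
  qed
  have X_pos: "0 < X n" if "0 < m n" "t \<le> n" for n
    using that t2 by (simp add: X_def)
  \<comment> \<open>The exponent of \<open>n\<close> in the growth condition is the one for which the degenerate walks, compared
    with \<open>X n\<close>, are measured by a power of \<open>r n\<close> alone.\<close>
  have error: "real n ^ (t - 1) / X n = (1 / (2 * r n)) ^ q" if "0 < m n" "t \<le> n" for n
  proof -
    have n: "0 < real n" using that t2 by simp
    have "(real n powr (real k - 1 / real q)) ^ q = real n powr (real q * (real k - 1 / real q))"
      using n by (simp add: powr_power mult.commute)
    also have "real q * (real k - 1 / real q) = real (t - 1 + (q - 1))"
      using assms(1-3) by (simp add: of_nat_diff algebra_simps)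
    also have "real n powr real (t - 1 + (q - 1)) = real n ^ (t - 1) * real n ^ (q - 1)"
      using n by (simp only: powr_realpow power_add)
    finally have "(real n powr (real k - 1 / real q)) ^ q = real n ^ (t - 1) * real n ^ (q - 1)" .
    then show ?thesis using n that by (simp add: X_def r_def field_simps power_mult_distrib)
  qed
  have X_z: "X n = real n * z n ^ (t - 1)" if "0 < m n" "t \<le> n" for n
  proof -
    have n: "0 < real n" using that t2 by simp
    have "z n ^ (t - 1) = (z n ^ (k - 1)) ^ q"
      using assms(3) by (simp add: mult.commute flip: power_mult)
    also have "z n ^ (k - 1) = 2 * real (m n) / real n"
      using assms(1) by (simp add: z_def)
    finally show ?thesis using n assms(2) by (cases q) (simp_all add: X_def field_simps)
  qed
  \<comment> \<open>Since \<open>k - 1/q \<ge> 1\<close>, already \<open>m n / n \<ge> r n\<close>.\<close>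
  have z_lim: "filterlim z at_top sequentially"
  proof (subst filterlim_at_top_gt[where c = 0], intro allI impI)
    fix Z :: real assume Z: "0 < Z"
    have "\<forall>\<^sub>F n in sequentially. Z ^ (k - 1) \<le> r n" using r by (simp add: filterlim_at_top)
    then show "\<forall>\<^sub>F n in sequentially. Z \<le> z n"
      using ev_m
    proof eventually_elim
      case (elim n)
      have n: "1 \<le> real n" using elim t2 by simp
      have "1 / real q \<le> 1" "2 \<le> real k" using assms(1,2) by simp_all
      then have "1 \<le> real k - 1 / real q" by linarith
      then have "real n powr 1 \<le> real n powr (real k - 1 / real q)"
        using n by (intro powr_mono) auto
      then have "r n \<le> real (m n) / real n"
        using n unfolding r_def by (intro divide_left_mono) auto
      also have "\<dots> \<le> 2 * real (m n) / real n" using n by (simp add: field_simps)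
      finally have "Z ^ (k - 1) \<le> 2 * real (m n) / real n" using elim by simp
      then have "root (k - 1) (Z ^ (k - 1)) \<le> z n"
        unfolding z_def using assms(1) by (intro real_root_le_mono) auto
      then show ?case using Z assms(1) by (simp add: real_root_power_cancel)
    qed
  qed
  define lo where "lo n = - (real t ^ 2 / 2) * (1 / (2 * r n)) ^ q" for n
  define hi where "hi n = ((1 + real k / z n) ^ (t - 1) - 1) / 2" for n
  have "(\<lambda>n. 1 / (2 * r n)) \<longlonglongrightarrow> 0"
    by (intro real_tendsto_divide_at_top[OF tendsto_const]
        filterlim_tendsto_pos_mult_at_top[OF tendsto_const _ r]) simp
  then have "(\<lambda>n. - (real t ^ 2 / 2) * (1 / (2 * r n)) ^ q) \<longlonglongrightarrow> - (real t ^ 2 / 2) * 0 ^ q"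
    by (intro tendsto_intros) auto
  then have lo_lim: "lo \<longlonglongrightarrow> 0"
    unfolding lo_def[abs_def] using assms(2) by (simp add: power_0_left)
  have "(\<lambda>n. real k / z n) \<longlonglongrightarrow> 0"
    by (rule real_tendsto_divide_at_top[OF tendsto_const z_lim])
  then have "(\<lambda>n. ((1 + real k / z n) ^ (t - 1) - 1) / 2) \<longlonglongrightarrow> ((1 + 0) ^ (t - 1) - 1) / 2"
    by (intro tendsto_intros) auto
  then have hi_lim: "hi \<longlonglongrightarrow> 0"
    unfolding hi_def[abs_def] by simp
  have ev_z: "\<forall>\<^sub>F n in sequentially. 1 \<le> z n" using z_lim by (simp add: filterlim_at_top)
  have bounds: "\<forall>\<^sub>F n in sequentially. lo n \<le> \<epsilon> n \<and> \<epsilon> n \<le> hi n"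
    using ev_m ev_r ev_z
  proof eventually_elim
    case (elim n)
    note mn = conjunct1[OF elim(1)] conjunct2[OF elim(1)]
    have n: "0 < real n" using mn t2 by simp
    have Xn: "0 < X n" by (rule X_pos[OF mn])
    have hi0: "0 \<le> hi n" using elim by (simp add: hi_def)
    have lo0: "lo n \<le> 0" using elim by (simp add: lo_def)
    show ?case
    proof (cases "S n = {}")
      case True
      then show ?thesis using hi0 lo0 by (simp add: \<epsilon>_def)
    next
      case False
      let ?N = "num_copies (path_graph t) :: nat graph \<Rightarrow> nat"
      have sx: "sx n = real (INF H \<in> S n. ?N H)" by (simp add: sx_def satex_def S_def)
      have "(INF H \<in> S n. ?N H) \<in> ?N ` S n" using False by (intro Inf_nat_def1) auto
      then obtain H where H: "H \<in> S n" "sx n = real (?N H)" by (auto simp: sx)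
      have "X n - real t ^ 2 * real n ^ (t - 1) \<le> 2 * sx n"
        using num_copies_path_ge[of H n k "m n" q t] H assms mn by (simp add: S_def X_def)
      then have "(X n - real t ^ 2 * real n ^ (t - 1)) / X n \<le> 2 * sx n / X n"
        using Xn by (intro divide_right_mono) auto
      then have "1 - real t ^ 2 * (real n ^ (t - 1) / X n) \<le> 2 * (sx n / X n)"
        using Xn by (simp add: diff_divide_distrib)
      then have lower: "lo n \<le> \<epsilon> n"
        using False unfolding error[OF mn] by (simp add: lo_def \<epsilon>_def)
      obtain H' where H': "H' \<in> S n" "2 * real (?N H') \<le> real n * (real k + z n) ^ (t - 1)"
        using exists_graph_few_paths[OF assms(1) mn(1) _ t2, of n] False
        by (auto simp: S_def z_def)
      have "sx n \<le> real (?N H')"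
        unfolding sx of_nat_le_iff using H'(1) by (intro cInf_lower) auto
      then have "2 * sx n / X n \<le> real n * (real k + z n) ^ (t - 1) / X n"
        using H'(2) Xn by (intro divide_right_mono) auto
      also have "\<dots> = ((real k + z n) / z n) ^ (t - 1)"
        using n by (simp add: X_z[OF mn] power_divide)
      also have "(real k + z n) / z n = 1 + real k / z n"
        using elim by (simp add: field_simps)
      finally have "\<epsilon> n \<le> hi n" using False by (simp add: \<epsilon>_def hi_def mult.commute)
      with lower show ?thesis by simp
    qed
  qed
  have "\<epsilon> \<longlonglongrightarrow> 0"
    by (rule tendsto_sandwich[OF _ _ lo_lim hi_lim])
      (use bounds in \<open>auto elim: eventually_mono\<close>)
  moreover have "\<forall>\<^sub>F n in sequentially. S n \<noteq> {} \<longrightarrow> sx n = (1 / 2 + \<epsilon> n) * X n"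
    using ev_m
  proof eventually_elim
    case (elim n)
    then have "0 < X n" using X_pos by blast
    then show ?case by (simp add: \<epsilon>_def)
  qed
  ultimately show ?thesis unfolding S_def sx_def X_def by blast
qed

end
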